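(* Let $M$ be a finite dimensional irreducible weight module of $U_v$. Then there exists exactly one maximal $\omega\in\mathrm{wt}(M)$, and $M$ is a highest weight module of highest weight $\omega$.
   Context: $n\ge2$ is an integer, $v$ an indeterminate, ground field $\mathbb Q(v)$, $P=\mathbb Q(v)\setminus\{0\}$. Let $\epsilon_1,\dots,\epsilon_n$ be orthonormal for $(\cdot,\cdot)$ and $\alpha_j=\epsilon_j-\epsilon_{j+1}$. The quantum queer superalgebra $U_v=U_v(\mathfrak q_n)$ is the $\mathbb Q(v)$-superalgebra generated by even $\mathsf K_i,\mathsf K_i^{-1},\mathsf E_j,\mathsf F_j$ and odd $\mathsf K_{\bar i},\mathsf E_{\bar j},\mathsf F_{\bar j}$ ($1\le i\le n$, $1\le j\le n-1$) with relations (for all indices for which they make sense): (QQ1) $\mathsf K_i\mathsf K_i^{-1}=\mathsf K_i^{-1}\mathsf K_i=1$, $\mathsf K_i\mathsf K_j=\mathsf K_j\mathsf K_i$, $\mathsf K_i\mathsf K_{\bar j}=\mathsf K_{\bar j}\mathsf K_i$, $\mathsf K_{\bar i}\mathsf K_{\bar j}+\mathsf K_{\bar j}\mathsf K_{\bar i}=2\delta_{i,j}\frac{\mathsf K_i^2-\mathsf K_i^{-2}}{v^2-v^{-2}}$; (QQ2) $\mathsf K_iX=v^{(\epsilon_i,\alpha_j)}X\mathsf K_i$ for $X=\mathsf E_j,\mathsf E_{\bar j}$; $\mathsf K_iX=v^{-(\epsilon_i,\alpha_j)}X\mathsf K_i$ for $X=\mathsf F_j,\mathsf F_{\bar j}$;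 (QQ3) $\mathsf K_{\bar i}\mathsf E_i-v\mathsf E_i\mathsf K_{\bar i}=\mathsf E_{\bar i}\mathsf K_i^{-1}$, $v\mathsf K_{\bar i}\mathsf E_{i-1}-\mathsf E_{i-1}\mathsf K_{\bar i}=-\mathsf K_i^{-1}\mathsf E_{\overline{i-1}}$, $\mathsf K_{\bar i}\mathsf F_i-v\mathsf F_i\mathsf K_{\bar i}=-\mathsf F_{\bar i}\mathsf K_i$, $v\mathsf K_{\bar i}\mathsf F_{i-1}-\mathsf F_{i-1}\mathsf K_{\bar i}=\mathsf K_i\mathsf F_{\overline{i-1}}$, $\mathsf K_{\bar i}\mathsf E_{\bar i}+v\mathsf E_{\bar i}\mathsf K_{\bar i}=\mathsf E_i\mathsf K_i^{-1}$, $v\mathsf K_{\bar i}\mathsf E_{\overline{i-1}}+\mathsf E_{\overline{i-1}}\mathsf K_{\bar i}=\mathsf K_i^{-1}\mathsf E_{i-1}$, $\mathsf K_{\bar i}\mathsf F_{\bar i}+v\mathsf F_{\bar i}\mathsf K_{\bar i}=\mathsf F_i\mathsf K_i$, $v\mathsf K_{\bar i}\mathsf F_{\overline{i-1}}+\mathsf F_{\overline{i-1}}\mathsf K_{\bar i}=\mathsf K_i\mathsf F_{i-1}$, and for $j\ne i,i-1$: $\mathsf K_{\bar i}\mathsf E_j-\mathsf E_j\mathsf K_{\bar i}=\mathsf K_{\bar i}\mathsf F_j-\mathsf F_j\mathsf K_{\bar i}=\mathsf K_{\bar i}\mathsf E_{\bar j}+\mathsf E_{\bar j}\mathsf K_{\bar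 i}=\mathsf K_{\bar i}\mathsf F_{\bar j}+\mathsf F_{\bar j}\mathsf K_{\bar i}=0$; (QQ4) $\mathsf E_i\mathsf F_j-\mathsf F_j\mathsf E_i=\delta_{i,j}\frac{\mathsf K_i\mathsf K_{i+1}^{-1}-\mathsf K_i^{-1}\mathsf K_{i+1}}{v-v^{-1}}$, $\mathsf E_{\bar i}\mathsf F_{\bar j}+\mathsf F_{\bar j}\mathsf E_{\bar i}=\delta_{i,j}\big(\frac{\mathsf K_i\mathsf K_{i+1}-\mathsf K_i^{-1}\mathsf K_{i+1}^{-1}}{v-v^{-1}}+(v-v^{-1})\mathsf K_{\bar i}\mathsf K_{\overline{i+1}}\big)$, $\mathsf E_i\mathsf F_{\bar j}-\mathsf F_{\bar j}\mathsf E_i=\delta_{i,j}(\mathsf K_{i+1}^{-1}\mathsf K_{\bar i}-\mathsf K_{\overline{i+1}}\mathsf K_i^{-1})$, $\mathsf E_{\bar i}\mathsf F_j-\mathsf F_j\mathsf E_{\bar i}=\delta_{i,j}(\mathsf K_{i+1}\mathsf K_{\bar i}-\mathsf K_{\overline{i+1}}\mathsf K_i)$; (QQ5) $\mathsf E_{\bar i}^2=-\frac{v-v^{-1}}{v+v^{-1}}\mathsf E_i^2$, $\mathsf F_{\bar i}^2=\frac{v-v^{-1}}{v+v^{-1}}\mathsf F_i^2$; for $|i-j|\ne1$: $\mathsf E_i\mathsf E_{\bar j}=\mathsf E_{\bar j}\mathsf E_i$, $\mathsf F_i\mathsf F_{\bar j}=\mathsf F_{\bar j}\mathsf F_i$;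 for $|i-j|>1$: $\mathsf E_i\mathsf E_j=\mathsf E_j\mathsf E_i$, $\mathsf F_i\mathsf F_j=\mathsf F_j\mathsf F_i$, $\mathsf E_{\bar i}\mathsf E_{\bar j}=-\mathsf E_{\bar j}\mathsf E_{\bar i}$, $\mathsf F_{\bar i}\mathsf F_{\bar j}=-\mathsf F_{\bar j}\mathsf F_{\bar i}$; $\mathsf E_i\mathsf E_{i+1}-v\mathsf E_{i+1}\mathsf E_i=\mathsf E_{\bar i}\mathsf E_{\overline{i+1}}+v\mathsf E_{\overline{i+1}}\mathsf E_{\bar i}$, $\mathsf E_i\mathsf E_{\overline{i+1}}-v\mathsf E_{\overline{i+1}}\mathsf E_i=\mathsf E_{\bar i}\mathsf E_{i+1}-v\mathsf E_{i+1}\mathsf E_{\bar i}$, $\mathsf F_i\mathsf F_{i+1}-v\mathsf F_{i+1}\mathsf F_i=-(\mathsf F_{\bar i}\mathsf F_{\overline{i+1}}+v\mathsf F_{\overline{i+1}}\mathsf F_{\bar i})$, $\mathsf F_i\mathsf F_{\overline{i+1}}-v\mathsf F_{\overline{i+1}}\mathsf F_i=\mathsf F_{\bar i}\mathsf F_{i+1}-v\mathsf F_{i+1}\mathsf F_{\bar i}$; (QQ6) for $|i-j|=1$: $\mathsf E_i^2X-(v+v^{-1})\mathsf E_iX\mathsf E_i+X\mathsf E_i^2=0$ for $X=\mathsf E_j,\mathsf E_{\bar j}$, and $\mathsf F_i^2Y-(v+v^{-1})\mathsf F_iY\mathsf F_i+Y\mathsf F_i^2=0$ for $Y=\mathsf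 F_j,\mathsf F_{\bar j}$. For a $U_v$-module $M$ (left module) and $\omega\in P^n$: $M_\omega=\{m\in M:\mathsf K_im=\omega_im,\ 1\le i\le n\}$; $\mathrm{wt}(M)=\{\omega\in P^n:M_\omega\ne0\}$; $M$ is a weight module if $M=\bigoplus_{\omega\in\mathrm{wt}(M)}M_\omega$. A nonzero $m\in M_\omega$ with $\mathsf E_jm=\mathsf E_{\bar j}m=0$ for all $1\le j\le n-1$ is a highest weight vector of weight $\omega$; $M$ is a highest weight module of highest weight $\omega$ if it is generated by a highest weight vector of weight $\omega$. Order: for $\mathbf k\in\mathbb Z^n$ put $v^{\mathbf k}\gamma=(v^{k_1}\gamma_1,\dots,v^{k_n}\gamma_n)$. For $\omega,\gamma\in P^n$, $\omega\ge\gamma$ if $\omega=v^{\beta}\gamma$ for some $\beta\in\bigoplus_{j=1}^{n-1}\mathbb N\alpha_j$ (viewing $\epsilon_i$ as the standard basis of $\mathbb Z^n$); $\omega>\gamma$ if also $\omega\ne\gamma$. $\omega\in\mathrm{wt}(M)$ is maximal if no $\gamma\in\mathrm{wt}(M)$ satisfies $\gamma>\omega$. *)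

theory Defs
  imports
    "HOL-Computational_Algebra.Polynomial"
    "HOL-Computational_Algebra.Fraction_Field"
    "HOL-Library.Poly_Mapping"
    "HOL-Library.FuncSet"
    "HOL-Algebra.QuotRing"
begin

section \<open>The ground field and the free algebra\<close>

type_synonym ratfun = "rat poly fract"

definition qv :: ratfun where
  "qv = Fract [:0, 1:] 1"

datatype 'a free_monoid = Word (letters: "'a list")

text \<open>
  The monoid operation (concatenation) is written additively because this is the form in which
  \<^typ>\<open>'a free_monoid \<Rightarrow>\<^sub>0 'k\<close> carries the convolution product, i.e. is the
  free associative algebra on \<^typ>\<open>'a\<close>.
\<close>

instantiation free_monoid :: (type) monoid_add
begin
definition zero_free_monoid :: "'a free_monoid" where
  "0 = Word []"
definition plus_free_monoid :: "'a free_monoid \<Rightarrow> 'a free_monoid \<Rightarrow> 'a free_monoid" where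
  "a + b = Word (letters a @ letters b)"
instance
  by standard (simp_all add: zero_free_monoid_def plus_free_monoid_def)
end

datatype gen =
    GK nat | GKinv nat | GE nat | GF nat
  | GKbar nat | GEbar nat | GFbar nat

definition gens :: "nat \<Rightarrow> gen set" where
  "gens n = GK ` {1..n} \<union> GKinv ` {1..n} \<union> GKbar ` {1..n} \<union>
     GE ` {1..n-1} \<union> GEbar ` {1..n-1} \<union> GF ` {1..n-1} \<union> GFbar ` {1..n-1}"

type_synonym free_el = "gen free_monoid \<Rightarrow>\<^sub>0 ratfun"

definition scal :: "ratfun \<Rightarrow> free_el" where
  "scal c = Poly_Mapping.single 0 c"

definition var :: "gen \<Rightarrow> free_el" where
  "var g = Poly_Mapping.single (Word [g]) 1"

abbreviation "xK i \<equiv> var (GK i)"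
abbreviation "xKinv i \<equiv> var (GKinv i)"
abbreviation "xKbar i \<equiv> var (GKbar i)"
abbreviation "xE i \<equiv> var (GE i)"
abbreviation "xEbar i \<equiv> var (GEbar i)"
abbreviation "xF i \<equiv> var (GF i)"
abbreviation "xFbar i \<equiv> var (GFbar i)"

definition free_alg :: "nat \<Rightarrow> free_el ring" where
  "free_alg n =
     \<lparr>carrier = {f. \<forall>w \<in> Poly_Mapping.keys f. set (letters w) \<subseteq> gens n},
      mult = (*), one = 1, zero = 0, add = (+)\<rparr>"


section \<open>Weights\<close>

definition eps :: "nat \<Rightarrow> nat \<Rightarrow> int" where
  "eps i = (\<lambda>k. if k = i then 1 else 0)"

definition alpha :: "nat \<Rightarrow> nat \<Rightarrow> int" where
  "alpha j = (\<lambda>k. eps j k - eps (j + 1) k)"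

definition form :: "nat \<Rightarrow> (nat \<Rightarrow> int) \<Rightarrow> (nat \<Rightarrow> int) \<Rightarrow> int" where
  "form n x y = (\<Sum>k=1..n. x k * y k)"

text \<open>The set $P^n$; tuples are functions that are \<^term>\<open>undefined\<close> outside $\{1,\dots,n\}$.\<close>

definition Pn :: "nat \<Rightarrow> (nat \<Rightarrow> ratfun) set" where
  "Pn n = {1..n} \<rightarrow>\<^sub>E (UNIV - {0})"

definition vshift :: "nat \<Rightarrow> (nat \<Rightarrow> int) \<Rightarrow> (nat \<Rightarrow> ratfun) \<Rightarrow> (nat \<Rightarrow> ratfun)" where
  "vshift n k \<gamma> = (\<lambda>i\<in>{1..n}. qv powi (k i) * \<gamma> i)"

definition positive_cone :: "nat \<Rightarrow> (nat \<Rightarrow> int) set" where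
  "positive_cone n =
     {\<beta>. \<exists>c :: nat \<Rightarrow> nat. \<beta> = (\<lambda>i. \<Sum>j=1..n-1. int (c j) * alpha j i)}"

definition weight_ge :: "nat \<Rightarrow> (nat \<Rightarrow> ratfun) \<Rightarrow> (nat \<Rightarrow> ratfun) \<Rightarrow> bool" where
  "weight_ge n \<omega> \<gamma> \<longleftrightarrow> (\<exists>\<beta> \<in> positive_cone n. \<omega> = vshift n \<beta> \<gamma>)"

definition weight_gt :: "nat \<Rightarrow> (nat \<Rightarrow> ratfun) \<Rightarrow> (nat \<Rightarrow> ratfun) \<Rightarrow> bool" where
  "weight_gt n \<omega> \<gamma> \<longleftrightarrow> weight_ge n \<omega> \<gamma> \<and> \<omega> \<noteq> \<gamma>"


section \<open>The quantum queer superalgebra\<close>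

text \<open>
  \<open>qq_rel n a b\<close> means that $a = b$ is one of the defining relations. Each relation is imposed
  for exactly those indices for which all generators occurring in it exist; in particular those
  involving the index $i-1$ require $i \ge 2$.
\<close>

inductive qq_rel :: "nat \<Rightarrow> free_el \<Rightarrow> free_el \<Rightarrow> bool" for n :: nat where
  QQ1a: "i \<in> {1..n} \<Longrightarrow> qq_rel n (xK i * xKinv i) 1"
| QQ1b: "i \<in> {1..n} \<Longrightarrow> qq_rel n (xKinv i * xK i) 1"
| QQ1c: "i \<in> {1..n} \<Longrightarrow> j \<in> {1..n} \<Longrightarrow> qq_rel n (xK i * xK j) (xK j * xK i)"
| QQ1d: "i \<in> {1..n} \<Longrightarrow> j \<in> {1..n} \<Longrightarrow> qq_rel n (xK i * xKbar j) (xKbar j * xK i)"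
| QQ1e: "i \<in> {1..n} \<Longrightarrow> j \<in> {1..n} \<Longrightarrow>
    qq_rel n (xKbar i * xKbar j + xKbar j * xKbar i)
      (if i = j then scal (2 / (qv ^ 2 - qv powi (-2))) * (xK i ^ 2 - xKinv i ^ 2) else 0)"

| QQ2a: "i \<in> {1..n} \<Longrightarrow> j \<in> {1..n-1} \<Longrightarrow> X \<in> {xE j, xEbar j} \<Longrightarrow>
    qq_rel n (xK i * X) (scal (qv powi (form n (eps i) (alpha j))) * X * xK i)"
| QQ2b: "i \<in> {1..n} \<Longrightarrow> j \<in> {1..n-1} \<Longrightarrow> X \<in> {xF j, xFbar j} \<Longrightarrow>
    qq_rel n (xK i * X) (scal (qv powi (- form n (eps i) (alpha j))) * X * xK i)"

| QQ3a: "i \<in> {1..n-1} \<Longrightarrow>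
    qq_rel n (xKbar i * xE i - scal qv * xE i * xKbar i) (xEbar i * xKinv i)"
| QQ3b: "i \<in> {2..n} \<Longrightarrow>
    qq_rel n (scal qv * xKbar i * xE (i-1) - xE (i-1) * xKbar i) (- (xKinv i * xEbar (i-1)))"
| QQ3c: "i \<in> {1..n-1} \<Longrightarrow>
    qq_rel n (xKbar i * xF i - scal qv * xF i * xKbar i) (- (xFbar i * xK i))"
| QQ3d: "i \<in> {2..n} \<Longrightarrow>
    qq_rel n (scal qv * xKbar i * xF (i-1) - xF (i-1) * xKbar i) (xK i * xFbar (i-1))"
| QQ3e: "i \<in> {1..n-1} \<Longrightarrow>
    qq_rel n (xKbar i * xEbar i + scal qv * xEbar i * xKbar i) (xE i * xKinv i)"
| QQ3f: "i \<in> {2..n} \<Longrightarrow>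
    qq_rel n (scal qv * xKbar i * xEbar (i-1) + xEbar (i-1) * xKbar i) (xKinv i * xE (i-1))"
| QQ3g: "i \<in> {1..n-1} \<Longrightarrow>
    qq_rel n (xKbar i * xFbar i + scal qv * xFbar i * xKbar i) (xF i * xK i)"
| QQ3h: "i \<in> {2..n} \<Longrightarrow>
    qq_rel n (scal qv * xKbar i * xFbar (i-1) + xFbar (i-1) * xKbar i) (xK i * xF (i-1))"
| QQ3i: "i \<in> {1..n} \<Longrightarrow> j \<in> {1..n-1} \<Longrightarrow> j \<noteq> i \<Longrightarrow> j \<noteq> i - 1 \<Longrightarrow>
    qq_rel n (xKbar i * xE j - xE j * xKbar i) 0"
| QQ3j: "i \<in> {1..n} \<Longrightarrow> j \<in> {1..n-1} \<Longrightarrow> j \<noteq> i \<Longrightarrow> j \<noteq> i - 1 \<Longrightarrow>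
    qq_rel n (xKbar i * xF j - xF j * xKbar i) 0"
| QQ3k: "i \<in> {1..n} \<Longrightarrow> j \<in> {1..n-1} \<Longrightarrow> j \<noteq> i \<Longrightarrow> j \<noteq> i - 1 \<Longrightarrow>
    qq_rel n (xKbar i * xEbar j + xEbar j * xKbar i) 0"
| QQ3l: "i \<in> {1..n} \<Longrightarrow> j \<in> {1..n-1} \<Longrightarrow> j \<noteq> i \<Longrightarrow> j \<noteq> i - 1 \<Longrightarrow>
    qq_rel n (xKbar i * xFbar j + xFbar j * xKbar i) 0"

| QQ4a: "i \<in> {1..n-1} \<Longrightarrow> j \<in> {1..n-1} \<Longrightarrow>
    qq_rel n (xE i * xF j - xF j * xE i)
      (if i = j then scal (1 / (qv - inverse qv)) * (xK i * xKinv (i+1) - xKinv i * xK (i+1))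
       else 0)"
| QQ4b: "i \<in> {1..n-1} \<Longrightarrow> j \<in> {1..n-1} \<Longrightarrow>
    qq_rel n (xEbar i * xFbar j + xFbar j * xEbar i)
      (if i = j then
         scal (1 / (qv - inverse qv)) * (xK i * xK (i+1) - xKinv i * xKinv (i+1))
         + scal (qv - inverse qv) * xKbar i * xKbar (i+1)
       else 0)"
| QQ4c: "i \<in> {1..n-1} \<Longrightarrow> j \<in> {1..n-1} \<Longrightarrow>
    qq_rel n (xE i * xFbar j - xFbar j * xE i)
      (if i = j then xKinv (i+1) * xKbar i - xKbar (i+1) * xKinv i else 0)"
| QQ4d: "i \<in> {1..n-1} \<Longrightarrow> j \<in> {1..n-1} \<Longrightarrow>
    qq_rel n (xEbar i * xF j - xF j * xEbar i)
      (if i = j then xK (i+1) * xKbar i - xKbar (i+1) * xK i else 0)"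

| QQ5a: "i \<in> {1..n-1} \<Longrightarrow>
    qq_rel n (xEbar i ^ 2) (- (scal ((qv - inverse qv) / (qv + inverse qv)) * xE i ^ 2))"
| QQ5b: "i \<in> {1..n-1} \<Longrightarrow>
    qq_rel n (xFbar i ^ 2) (scal ((qv - inverse qv) / (qv + inverse qv)) * xF i ^ 2)"
| QQ5c: "i \<in> {1..n-1} \<Longrightarrow> j \<in> {1..n-1} \<Longrightarrow> \<bar>int i - int j\<bar> \<noteq> 1 \<Longrightarrow>
    qq_rel n (xE i * xEbar j) (xEbar j * xE i)"
| QQ5d: "i \<in> {1..n-1} \<Longrightarrow> j \<in> {1..n-1} \<Longrightarrow> \<bar>int i - int j\<bar> \<noteq> 1 \<Longrightarrow>
    qq_rel n (xF i * xFbar j) (xFbar j * xF i)"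
| QQ5e: "i \<in> {1..n-1} \<Longrightarrow> j \<in> {1..n-1} \<Longrightarrow> \<bar>int i - int j\<bar> > 1 \<Longrightarrow>
    qq_rel n (xE i * xE j) (xE j * xE i)"
| QQ5f: "i \<in> {1..n-1} \<Longrightarrow> j \<in> {1..n-1} \<Longrightarrow> \<bar>int i - int j\<bar> > 1 \<Longrightarrow>
    qq_rel n (xF i * xF j) (xF j * xF i)"
| QQ5g: "i \<in> {1..n-1} \<Longrightarrow> j \<in> {1..n-1} \<Longrightarrow> \<bar>int i - int j\<bar> > 1 \<Longrightarrow>
    qq_rel n (xEbar i * xEbar j) (- (xEbar j * xEbar i))"
| QQ5h: "i \<in> {1..n-1} \<Longrightarrow> j \<in> {1..n-1} \<Longrightarrow> \<bar>int i - int j\<bar> > 1 \<Longrightarrow>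
    qq_rel n (xFbar i * xFbar j) (- (xFbar j * xFbar i))"
| QQ5i: "i \<in> {1..n-2} \<Longrightarrow>
    qq_rel n (xE i * xE (i+1) - scal qv * xE (i+1) * xE i)
      (xEbar i * xEbar (i+1) + scal qv * xEbar (i+1) * xEbar i)"
| QQ5j: "i \<in> {1..n-2} \<Longrightarrow>
    qq_rel n (xE i * xEbar (i+1) - scal qv * xEbar (i+1) * xE i)
      (xEbar i * xE (i+1) - scal qv * xE (i+1) * xEbar i)"
| QQ5k: "i \<in> {1..n-2} \<Longrightarrow>
    qq_rel n (xF i * xF (i+1) - scal qv * xF (i+1) * xF i)
      (- (xFbar i * xFbar (i+1) + scal qv * xFbar (i+1) * xFbar i))"
| QQ5l: "i \<in> {1..n-2} \<Longrightarrow>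
    qq_rel n (xF i * xFbar (i+1) - scal qv * xFbar (i+1) * xF i)
      (xFbar i * xF (i+1) - scal qv * xF (i+1) * xFbar i)"

| QQ6a: "i \<in> {1..n-1} \<Longrightarrow> j \<in> {1..n-1} \<Longrightarrow> \<bar>int i - int j\<bar> = 1 \<Longrightarrow>
    X \<in> {xE j, xEbar j} \<Longrightarrow>
    qq_rel n (xE i ^ 2 * X - scal (qv + inverse qv) * xE i * X * xE i + X * xE i ^ 2) 0"
| QQ6b: "i \<in> {1..n-1} \<Longrightarrow> j \<in> {1..n-1} \<Longrightarrow> \<bar>int i - int j\<bar> = 1 \<Longrightarrow>
    Y \<in> {xF j, xFbar j} \<Longrightarrow>
    qq_rel n (xF i ^ 2 * Y - scal (qv + inverse qv) * xF i * Y * xF i + Y * xF i ^ 2) 0"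

definition qq_ideal :: "nat \<Rightarrow> free_el set" where
  "qq_ideal n = Idl\<^bsub>free_alg n\<^esub> {a - b | a b. qq_rel n a b}"

text \<open>
  The $\mathbb{Z}/2$-grading of the algebra (generators with a bar are odd, the other ones even)
  is not recorded, because modules, submodules and weight spaces below do not refer to it.
\<close>

definition Uv :: "nat \<Rightarrow> free_el set ring" where
  "Uv n = free_alg n Quot qq_ideal n"

definition U_class :: "nat \<Rightarrow> free_el \<Rightarrow> free_el set" where
  "U_class n a = qq_ideal n +>\<^bsub>free_alg n\<^esub> a"


section \<open>Modules\<close>

text \<open>
  Unital left modules over a not necessarily commutative ring; the underlying abelian group is a
  whole type. (The locale \<open>module\<close> of HOL-Algebra is restricted to commutative rings.)
\<close>

locale left_module = ring R
  for R (structure) and act :: "'r \<Rightarrow> 'm :: ab_group_add \<Rightarrow> 'm" +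
  assumes act_add_right: "a \<in> carrier R \<Longrightarrow> act a (x + y) = act a x + act a y"
    and act_add_left: "a \<in> carrier R \<Longrightarrow> b \<in> carrier R \<Longrightarrow> act (a \<oplus> b) x = act a x + act b x"
    and act_mult: "a \<in> carrier R \<Longrightarrow> b \<in> carrier R \<Longrightarrow> act (a \<otimes> b) x = act a (act b x)"
    and act_one: "act \<one> x = x"

definition submodule_of ::
  "('r, 'b) ring_scheme \<Rightarrow> ('r \<Rightarrow> 'm :: ab_group_add \<Rightarrow> 'm) \<Rightarrow> 'm set \<Rightarrow> bool" where
  "submodule_of R act N \<longleftrightarrow>
     0 \<in> N \<and> (\<forall>x\<in>N. \<forall>y\<in>N. x + y \<in> N) \<and> (\<forall>a\<in>carrier R. \<forall>x\<in>N. act a x \<in> N)"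

definition irreducible_module ::
  "('r, 'b) ring_scheme \<Rightarrow> ('r \<Rightarrow> 'm :: ab_group_add \<Rightarrow> 'm) \<Rightarrow> bool" where
  "irreducible_module R act \<longleftrightarrow>
     (UNIV :: 'm set) \<noteq> {0} \<and> (\<forall>N. submodule_of R act N \<longrightarrow> N = {0} \<or> N = UNIV)"

text \<open>The vector space structure that a module inherits along $\mathbb{Q}(v) \to U_v$.\<close>

definition qv_scale :: "nat \<Rightarrow> (free_el set \<Rightarrow> 'm \<Rightarrow> 'm) \<Rightarrow> ratfun \<Rightarrow> 'm \<Rightarrow> 'm" where
  "qv_scale n act c = act (U_class n (scal c))"

definition finite_dim_module :: "nat \<Rightarrow> (free_el set \<Rightarrow> 'm :: ab_group_add \<Rightarrow> 'm) \<Rightarrow> bool" where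
  "finite_dim_module n act \<longleftrightarrow> (\<exists>B. finite_dimensional_vector_space (qv_scale n act) B)"

definition weight_space ::
  "nat \<Rightarrow> (free_el set \<Rightarrow> 'm :: ab_group_add \<Rightarrow> 'm) \<Rightarrow> (nat \<Rightarrow> ratfun) \<Rightarrow> 'm set" where
  "weight_space n act \<omega> =
     {m. \<forall>i\<in>{1..n}. act (U_class n (xK i)) m = qv_scale n act (\<omega> i) m}"

definition wt :: "nat \<Rightarrow> (free_el set \<Rightarrow> 'm :: ab_group_add \<Rightarrow> 'm) \<Rightarrow> (nat \<Rightarrow> ratfun) set" where
  "wt n act = {\<omega> \<in> Pn n. weight_space n act \<omega> \<noteq> {0}}"

text \<open>
  The internal direct sum decomposition: every vector has a unique family of components, almost
  all of them zero.
\<close>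

definition weight_module :: "nat \<Rightarrow> (free_el set \<Rightarrow> 'm :: ab_group_add \<Rightarrow> 'm) \<Rightarrow> bool" where
  "weight_module n act \<longleftrightarrow>
     (\<forall>m. \<exists>!f :: (nat \<Rightarrow> ratfun) \<Rightarrow> 'm.
        (\<forall>\<omega>\<in>wt n act. f \<omega> \<in> weight_space n act \<omega>) \<and> (\<forall>\<omega>. \<omega> \<notin> wt n act \<longrightarrow> f \<omega> = 0) \<and>
        finite {\<omega>. f \<omega> \<noteq> 0} \<and> m = (\<Sum>\<omega> | f \<omega> \<noteq> 0. f \<omega>))"

definition highest_weight_vector ::
  "nat \<Rightarrow> (free_el set \<Rightarrow> 'm :: ab_group_add \<Rightarrow> 'm) \<Rightarrow> (nat \<Rightarrow> ratfun) \<Rightarrow> 'm \<Rightarrow> bool" where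
  "highest_weight_vector n act \<omega> m \<longleftrightarrow>
     \<omega> \<in> Pn n \<and> m \<noteq> 0 \<and> m \<in> weight_space n act \<omega> \<and>
     (\<forall>j\<in>{1..n-1}. act (U_class n (xE j)) m = 0 \<and> act (U_class n (xEbar j)) m = 0)"

definition highest_weight_module ::
  "nat \<Rightarrow> (free_el set \<Rightarrow> 'm :: ab_group_add \<Rightarrow> 'm) \<Rightarrow> (nat \<Rightarrow> ratfun) \<Rightarrow> bool" where
  "highest_weight_module n act \<omega> \<longleftrightarrow>
     (\<exists>m. highest_weight_vector n act \<omega> m \<and> submodule_of (Uv n) act hull {m} = UNIV)"

definition maximal_weight ::
  "nat \<Rightarrow> (free_el set \<Rightarrow> 'm :: ab_group_add \<Rightarrow> 'm) \<Rightarrow> (nat \<Rightarrow> ratfun) \<Rightarrow> bool" where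
  "maximal_weight n act \<omega> \<longleftrightarrow>
     \<omega> \<in> wt n act \<and> \<not> (\<exists>\<gamma>\<in>wt n act. weight_gt n \<gamma> \<omega>)"


section \<open>Well-formedness of the presentation\<close>

lemma carrier_free_alg_iff:
  "f \<in> carrier (free_alg n) \<longleftrightarrow> (\<forall>w \<in> Poly_Mapping.keys f. set (letters w) \<subseteq> gens n)"
  by (simp add: free_alg_def)

lemma free_alg_sel [simp]:
  "mult (free_alg n) = (*)" "one (free_alg n) = 1" "zero (free_alg n) = 0" "add (free_alg n) = (+)"
  by (simp_all add: free_alg_def)

lemma scal_in_free_alg: "scal c \<in> carrier (free_alg n)"
  by (simp add: carrier_free_alg_iff scal_def zero_free_monoid_def)

lemma var_in_free_alg: "g \<in> gens n \<Longrightarrow> var g \<in> carrier (free_alg n)"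
  by (simp add: carrier_free_alg_iff var_def)

lemma one_in_free_alg: "1 \<in> carrier (free_alg n)"
  using scal_in_free_alg [of 1 n] by (simp add: scal_def)

lemma zero_in_free_alg: "0 \<in> carrier (free_alg n)"
  by (simp add: carrier_free_alg_iff)

lemma add_in_free_alg:
  "a \<in> carrier (free_alg n) \<Longrightarrow> b \<in> carrier (free_alg n) \<Longrightarrow> a + b \<in> carrier (free_alg n)"
  using Poly_Mapping.keys_add [of a b] unfolding carrier_free_alg_iff by blast

lemma uminus_in_free_alg: "a \<in> carrier (free_alg n) \<Longrightarrow> - a \<in> carrier (free_alg n)"
  by (simp add: carrier_free_alg_iff)

lemma diff_in_free_alg:
  "a \<in> carrier (free_alg n) \<Longrightarrow> b \<in> carrier (free_alg n) \<Longrightarrow> a - b \<in> carrier (free_alg n)"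
  using add_in_free_alg [of a n "- b"] by (simp add: uminus_in_free_alg)

lemma mult_in_free_alg:
  assumes "a \<in> carrier (free_alg n)" "b \<in> carrier (free_alg n)"
  shows "a * b \<in> carrier (free_alg n)"
  unfolding carrier_free_alg_iff
proof
  fix w assume "w \<in> Poly_Mapping.keys (a * b)"
  then obtain x y where "w = x + y" "x \<in> Poly_Mapping.keys a" "y \<in> Poly_Mapping.keys b"
    using Poly_Mapping.keys_mult [of a b] by blast
  then show "set (letters w) \<subseteq> gens n"
    using assms by (simp add: carrier_free_alg_iff plus_free_monoid_def)
qed

lemma power_in_free_alg: "a \<in> carrier (free_alg n) \<Longrightarrow> a ^ k \<in> carrier (free_alg n)"
  by (induction k) (simp_all add: one_in_free_alg mult_in_free_alg)

lemmas free_alg_closed =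
  scal_in_free_alg var_in_free_alg one_in_free_alg zero_in_free_alg add_in_free_alg
  uminus_in_free_alg diff_in_free_alg mult_in_free_alg power_in_free_alg

lemma ring_free_alg: "ring (free_alg n)"
proof (rule ringI)
  show "abelian_group (free_alg n)"
  proof (rule abelian_groupI)
    fix x assume "x \<in> carrier (free_alg n)"
    then show "\<exists>y\<in>carrier (free_alg n). y \<oplus>\<^bsub>free_alg n\<^esub> x = \<zero>\<^bsub>free_alg n\<^esub>"
      by (intro bexI [of _ "- x"]) (simp_all add: free_alg_closed)
  qed (simp_all add: free_alg_closed ac_simps)
  show "Group.monoid (free_alg n)"
    by (rule monoidI) (simp_all add: free_alg_closed mult.assoc)
qed (simp_all add: algebra_simps)

lemma gens_iff [simp]:
  "GK i \<in> gens n \<longleftrightarrow> i \<in> {1..n}" "GKinv i \<in> gens n \<longleftrightarrow> i \<in> {1..n}"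
  "GKbar i \<in> gens n \<longleftrightarrow> i \<in> {1..n}"
  "GE i \<in> gens n \<longleftrightarrow> i \<in> {1..n-1}" "GEbar i \<in> gens n \<longleftrightarrow> i \<in> {1..n-1}"
  "GF i \<in> gens n \<longleftrightarrow> i \<in> {1..n-1}" "GFbar i \<in> gens n \<longleftrightarrow> i \<in> {1..n-1}"
  unfolding gens_def by auto

lemma qq_rel_in_free_alg:
  assumes "qq_rel n a b"
  shows "a \<in> carrier (free_alg n)" "b \<in> carrier (free_alg n)"
  using assms by (cases; force intro!: free_alg_closed split: if_splits)+

lemma ideal_qq_ideal: "ideal (qq_ideal n) (free_alg n)"
  unfolding qq_ideal_def
  by (rule ring.genideal_ideal [OF ring_free_alg])
    (auto intro: diff_in_free_alg dest: qq_rel_in_free_alg)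

lemma ring_Uv: "ring (Uv n)"
  unfolding Uv_def by (rule ideal.quotient_is_ring [OF ideal_qq_ideal])

lemma U_class_hom: "U_class n \<in> ring_hom (free_alg n) (Uv n)"
  using ideal.rcos_ring_hom [OF ideal_qq_ideal] by (simp add: Uv_def U_class_def [abs_def])

lemma U_class_rel:
  assumes "qq_rel n a b"
  shows "U_class n a = U_class n b"
proof -
  interpret ring "free_alg n" by (rule ring_free_alg)
  interpret I: ideal "qq_ideal n" "free_alg n" by (rule ideal_qq_ideal)
  have "{a - b | a b. qq_rel n a b} \<subseteq> qq_ideal n"
    unfolding qq_ideal_def
    by (rule genideal_self) (auto intro: diff_in_free_alg dest: qq_rel_in_free_alg)
  then have "a - b \<in> qq_ideal n" using assms by blast
  then have "a \<in> U_class n b"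
    unfolding U_class_def a_r_coset_def r_coset_def by (auto intro!: bexI [of _ "a - b"])
  then show ?thesis
    unfolding U_class_def
    using I.a_repr_independence' qq_rel_in_free_alg [OF assms] by metis
qed

text \<open>
  In particular, the vector space axioms contained in \<^const>\<open>finite_dim_module\<close> hold for
  every module, so that \<^const>\<open>finite_dim_module\<close> only asks for a finite basis.
\<close>

lemma vector_space_qv_scale:
  assumes "left_module (Uv n) act"
  shows "vector_space (qv_scale n act)"
proof -
  interpret left_module "Uv n" act by (rule assms)
  note cl = ring_hom_closed [OF U_class_hom scal_in_free_alg]
  have add: "U_class n (scal (a + b)) = U_class n (scal a) \<oplus>\<^bsub>Uv n\<^esub> U_class n (scal b)" for a b
    using ring_hom_add [OF U_class_hom scal_in_free_alg scal_in_free_alg, of n a b]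
    by (simp add: scal_def single_add)
  have mult: "U_class n (scal (a * b)) = U_class n (scal a) \<otimes>\<^bsub>Uv n\<^esub> U_class n (scal b)" for a b
    using ring_hom_mult [OF U_class_hom scal_in_free_alg scal_in_free_alg, of n a b]
    by (simp add: scal_def mult_single)
  have one: "U_class n (scal 1) = \<one>\<^bsub>Uv n\<^esub>"
    using ring_hom_one [OF U_class_hom, of n] by (simp add: scal_def)
  show ?thesis
    by unfold_locales (simp_all add: qv_scale_def act_add_right add act_add_left mult act_mult
        one act_one cl)
qed

end

theory Submission
  imports Defs
begin

text \<open>
  A finite dimensional weight module has only finitely many weights, because each of the finitely
  many basis vectors involves only finitely many of them (\<open>finite_wt\<close>). As $v$ is not a root of
  unity and a nonzero element of the positive cone has positive height, the relation
  \<^const>\<open>weight_ge\<close> is a partial order, so a maximal weight $\omega$ exists. The operators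
  $\mathsf E_j$ and $\mathsf E_{\bar j}$ raise weights by $\alpha_j$; hence they annihilate the
  whole weight space $M_\omega$, and every nonzero vector of $M_\omega$ is a highest weight vector.
  It generates $M$ by irreducibility.

  The point of substance is uniqueness, for which one needs the spanning half of a triangular
  decomposition. Let $N$ be the smallest subspace that contains the whole weight space $M_\omega$ and
  is stable under all $\mathsf F_j$ and $\mathsf F_{\bar j}$ (the set \<open>lowerings\<close>). Starting from all
  of $M_\omega$, rather than from one vector of it, makes the base case trivial: $M_\omega$ is stable
  under $\mathsf K_i^{\pm1}$ and $\mathsf K_{\bar i}$, which commute with the $\mathsf K_j$, and it is
  annihilated by the raising operators. The defining relations move each $\mathsf K_i^{\pm1}$ and
  $\mathsf K_{\bar i}$ past a lowering operator, with only lowering operators and elements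
  $\mathsf K_k^{\pm1}$, $\mathsf K_{\bar k}$ in the result; then they move each raising operator past
  a lowering operator at the cost of a term in these $\mathsf K$'s alone. So $N$ is a submodule (\<open>submodule_lowerings\<close>), and $N = M$ by
  irreducibility.

  On the other hand every vector of $N$ is a sum of weight vectors of weights $\le \omega$
  (\<open>lowerings_subset_span\<close>), and weight components are unique. Therefore every weight of $M$
  is $\le \omega$ (\<open>weight_ge_if_lowerings_UNIV\<close>), and a second maximal weight
  must equal $\omega$.
\<close>


section \<open>The order on weights\<close>

lemma qv_nonzero: "qv \<noteq> 0"
  by (simp add: qv_def Zero_fract_def eq_fract)

text \<open>
  The indeterminate is not a root of unity, as the polynomial $X^k$ has degree $k$.
\<close>

lemma qv_power_eq_1_iff: "qv ^ k = 1 \<longleftrightarrow> k = 0"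
proof
  assume "qv ^ k = 1"
  moreover have "qv ^ k = Fract ([:0, 1:] ^ k) 1"
    by (induction k) (simp_all add: qv_def One_fract_def)
  ultimately have "([:0, 1:] :: rat poly) ^ k = 1"
    by (simp add: One_fract_def eq_fract)
  moreover have "degree (([:0, 1:] :: rat poly) ^ k) = k"
    by (simp add: degree_power_eq)
  ultimately show "k = 0" by simp
qed simp

lemma qv_powi_eq_1_iff: "qv powi k = 1 \<longleftrightarrow> k = 0"
  using qv_power_eq_1_iff [of "nat k"] qv_power_eq_1_iff [of "nat (- k)"]
  by (auto simp: power_int_def power_inverse split: if_splits)

lemma vshift_in_Pn: "\<gamma> \<in> Pn n \<Longrightarrow> vshift n \<beta> \<gamma> \<in> Pn n"
  by (auto simp: Pn_def vshift_def qv_nonzero PiE_iff)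

lemma vshift_vshift: "vshift n \<beta> (vshift n \<delta> \<gamma>) = vshift n (\<lambda>i. \<beta> i + \<delta> i) \<gamma>"
  by (auto simp: vshift_def power_int_add qv_nonzero)

lemma vshift_zero: "\<gamma> \<in> Pn n \<Longrightarrow> vshift n (\<lambda>i. 0) \<gamma> = \<gamma>"
  by (auto simp: vshift_def Pn_def PiE_def extensional_def restrict_def)

lemma vshift_eq_self_iff:
  assumes "\<gamma> \<in> Pn n"
  shows "vshift n \<beta> \<gamma> = \<gamma> \<longleftrightarrow> (\<forall>i\<in>{1..n}. \<beta> i = 0)"
proof
  assume eq: "vshift n \<beta> \<gamma> = \<gamma>"
  show "\<forall>i\<in>{1..n}. \<beta> i = 0"
  proof
    fix i assume i: "i \<in> {1..n}"
    then have "qv powi (\<beta> i) * \<gamma> i = \<gamma> i" using fun_cong [OF eq, of i] by (simp add: vshift_def)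
    moreover have "\<gamma> i \<noteq> 0" using assms i by (auto simp: Pn_def)
    ultimately show "\<beta> i = 0" by (simp add: qv_powi_eq_1_iff)
  qed
next
  assume "\<forall>i\<in>{1..n}. \<beta> i = 0"
  then have "vshift n \<beta> \<gamma> = vshift n (\<lambda>i. 0) \<gamma>" by (auto simp: vshift_def)
  then show "vshift n \<beta> \<gamma> = \<gamma>" using assms by (simp add: vshift_zero)
qed

lemma positive_cone_zero: "(\<lambda>i. 0) \<in> positive_cone n"
  unfolding positive_cone_def by (auto intro!: exI [of _ "\<lambda>_. 0"])

lemma positive_cone_add:
  assumes "\<beta> \<in> positive_cone n" "\<delta> \<in> positive_cone n"
  shows "(\<lambda>i. \<beta> i + \<delta> i) \<in> positive_cone n"
proof -
  obtain c d :: "nat \<Rightarrow> nat" where "\<beta> = (\<lambda>i. \<Sum>j=1..n-1. int (c j) * alpha j i)"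
    "\<delta> = (\<lambda>i. \<Sum>j=1..n-1. int (d j) * alpha j i)"
    using assms unfolding positive_cone_def by blast
  then show ?thesis
    unfolding positive_cone_def
    by (auto intro!: exI [of _ "\<lambda>j. c j + d j"] simp: sum.distrib algebra_simps)
qed

lemma alpha_in_positive_cone:
  assumes "j \<in> {1..n-1}"
  shows "alpha j \<in> positive_cone n"
proof -
  have "alpha j i = (\<Sum>k=1..n-1. int (if k = j then 1 else 0) * alpha k i)" for i
  proof -
    have "(\<Sum>k=1..n-1. int (if k = j then 1 else 0) * alpha k i)
        = (\<Sum>k=1..n-1. if k = j then alpha k i else 0)" by (intro sum.cong) auto
    then show ?thesis using assms by simp
  qed
  then show ?thesis
    unfolding positive_cone_def by (auto intro!: exI [of _ "\<lambda>k. if k = j then 1 else 0"])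
qed

text \<open>
  The linear functional $\beta \mapsto -\sum_i i\,\beta_i$ takes the value $1$ on every simple root,
  so it reads off the height of an element of the positive cone.
\<close>

lemma height_of_sum:
  "- (\<Sum>i=1..n. int i * (\<Sum>j=1..n-1. int (c j) * alpha j i)) = int (\<Sum>j=1..n-1. c j)"
proof -
  have height_alpha: "(\<Sum>i=1..n. int i * alpha j i) = -1" if "j \<in> {1..n-1}" for j
  proof -
    have "(\<Sum>i=1..n. int i * alpha j i)
        = (\<Sum>i=1..n. (if i = j then int i else 0) - (if i = j + 1 then int i else 0))"
      by (intro sum.cong) (auto simp: alpha_def eps_def)
    also have "\<dots> = -1" using that by (subst sum_subtractf) auto
    finally show ?thesis .
  qed
  have "(\<Sum>i=1..n. int i * (\<Sum>j=1..n-1. int (c j) * alpha j i))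
      = (\<Sum>j=1..n-1. int (c j) * (\<Sum>i=1..n. int i * alpha j i))"
    unfolding sum_distrib_left by (subst sum.swap) (simp add: mult.left_commute)
  also have "\<dots> = (\<Sum>j=1..n-1. - int (c j))"
    using height_alpha by (intro sum.cong) auto
  finally show ?thesis by (simp add: sum_negf)
qed

text \<open>
  Heights of elements of the cone are nonnegative, so if two of them cancel then both heights, and
  with them all coefficients of the simple roots, are zero.
\<close>

lemma positive_cone_pointed:
  assumes "\<beta> \<in> positive_cone n" "\<delta> \<in> positive_cone n" "\<forall>i\<in>{1..n}. \<beta> i + \<delta> i = 0"
  shows "\<beta> = (\<lambda>i. 0)"
proof -
  obtain c d :: "nat \<Rightarrow> nat" where c: "\<beta> = (\<lambda>i. \<Sum>j=1..n-1. int (c j) * alpha j i)"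
    and d: "\<delta> = (\<lambda>i. \<Sum>j=1..n-1. int (d j) * alpha j i)"
    using assms unfolding positive_cone_def by blast
  have "int (\<Sum>j=1..n-1. c j) + int (\<Sum>j=1..n-1. d j) = - (\<Sum>i=1..n. int i * (\<beta> i + \<delta> i))"
    unfolding height_of_sum [where n = n, symmetric] c d by (simp add: sum.distrib distrib_left)
  also have "\<dots> = 0" using assms(3) by simp
  finally have "(\<Sum>j=1..n-1. c j) = 0" by linarith
  then show ?thesis by (simp add: c)
qed

lemma weight_ge_refl: "\<gamma> \<in> Pn n \<Longrightarrow> weight_ge n \<gamma> \<gamma>"
  unfolding weight_ge_def using positive_cone_zero by (force simp: vshift_zero)

lemma weight_ge_trans:
  assumes "weight_ge n \<omega> \<gamma>" "weight_ge n \<gamma> \<delta>"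
  shows "weight_ge n \<omega> \<delta>"
  using assms unfolding weight_ge_def by (auto simp: vshift_vshift intro: positive_cone_add)

lemma weight_ge_antisym:
  assumes "weight_ge n \<omega> \<gamma>" "weight_ge n \<gamma> \<omega>" "\<gamma> \<in> Pn n"
  shows "\<omega> = \<gamma>"
proof -
  obtain \<beta> \<delta> where \<beta>: "\<beta> \<in> positive_cone n" "\<omega> = vshift n \<beta> \<gamma>"
    and \<delta>: "\<delta> \<in> positive_cone n" "\<gamma> = vshift n \<delta> \<omega>"
    using assms unfolding weight_ge_def by blast
  have "vshift n (\<lambda>i. \<delta> i + \<beta> i) \<gamma> = \<gamma>" using \<beta>(2) \<delta>(2) by (metis vshift_vshift)
  then have "\<forall>i\<in>{1..n}. \<beta> i + \<delta> i = 0"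
    using assms(3) by (simp add: vshift_eq_self_iff add.commute)
  then show ?thesis using positive_cone_pointed \<beta> \<delta> assms(3) vshift_zero by metis
qed

lemma ex_maximal_for_weight_gt:
  assumes "finite S" "S \<noteq> {}" "S \<subseteq> Pn n"
  shows "\<exists>\<omega>\<in>S. \<not> (\<exists>\<gamma>\<in>S. weight_gt n \<gamma> \<omega>)"
proof -
  have "asymp_on S (\<lambda>x y. weight_gt n y x)"
    using assms(3) by (intro asymp_onI) (auto simp: weight_gt_def dest: weight_ge_antisym)
  moreover have "transp_on S (\<lambda>x y. weight_gt n y x)"
    using assms(3)
    by (intro transp_onI) (auto simp: weight_gt_def dest: weight_ge_antisym weight_ge_trans)
  ultimately obtain \<omega> where "\<omega> \<in> S" "\<forall>x\<in>S. x \<noteq> \<omega> \<longrightarrow> \<not> weight_gt n x \<omega>"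
    using Finite_Set.bex_max_element [OF assms(1) _ _ assms(2)] by blast
  then show ?thesis by (auto simp: weight_gt_def)
qed

lemma weight_ge_vshift_minus_alpha:
  assumes "j \<in> {1..n-1}" "\<gamma> \<in> Pn n"
  shows "weight_ge n \<gamma> (vshift n (\<lambda>i. - alpha j i) \<gamma>)"
  using alpha_in_positive_cone [OF assms(1)]
  by (force simp: weight_ge_def vshift_vshift vshift_zero assms(2))

lemma weight_gt_vshift_alpha:
  assumes "j \<in> {1..n-1}" "\<gamma> \<in> Pn n"
  shows "weight_gt n (vshift n (alpha j) \<gamma>) \<gamma>"
proof -
  have "alpha j j \<noteq> 0" "j \<in> {1..n}" using assms by (auto simp: alpha_def eps_def)
  then show ?thesis
    using alpha_in_positive_cone [OF assms(1)] vshift_eq_self_iff [OF assms(2), of "alpha j"]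
    by (auto simp: weight_gt_def weight_ge_def)
qed

lemma form_eps:
  assumes "i \<in> {1..n}"
  shows "form n (eps i) x = x i"
proof -
  have "form n (eps i) x = (\<Sum>k=1..n. if k = i then x k else 0)"
    unfolding form_def by (intro sum.cong) (auto simp: eps_def)
  then show ?thesis using assms by simp
qed


lemma sum_single_lookup:
  "(\<Sum>w\<in>Poly_Mapping.keys f. Poly_Mapping.single w (Poly_Mapping.lookup f w)) = f"
proof (rule poly_mapping_eqI)
  fix k
  show "Poly_Mapping.lookup (\<Sum>w\<in>Poly_Mapping.keys f.
      Poly_Mapping.single w (Poly_Mapping.lookup f w)) k = Poly_Mapping.lookup f k"
    by (simp add: lookup_sum lookup_single when_def in_keys_iff)
qed


section \<open>Modules as representations of the free algebra\<close>

locale qq_module = left_module "Uv n" act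
  for n :: nat and act :: "free_el set \<Rightarrow> 'm :: ab_group_add \<Rightarrow> 'm"
begin

abbreviation scale :: "ratfun \<Rightarrow> 'm \<Rightarrow> 'm" where
  "scale \<equiv> qv_scale n act"

sublocale vector_space "qv_scale n act"
  by (rule vector_space_qv_scale) (rule left_module_axioms)

text \<open>
  The module as a representation of the free algebra. Computing with representatives instead of
  cosets, the defining relations of $U_v$ become equations between operators (\<open>rep_rel\<close>).
\<close>

definition rep :: "free_el \<Rightarrow> 'm \<Rightarrow> 'm" where
  "rep a = act (U_class n a)"

lemma U_class_closed: "a \<in> carrier (free_alg n) \<Longrightarrow> U_class n a \<in> carrier (Uv n)"
  by (rule ring_hom_closed [OF U_class_hom])

lemma rep_add_right: "a \<in> carrier (free_alg n) \<Longrightarrow> rep a (x + y) = rep a x + rep a y"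
  by (simp add: rep_def act_add_right U_class_closed)

lemma rep_add:
  "a \<in> carrier (free_alg n) \<Longrightarrow> b \<in> carrier (free_alg n) \<Longrightarrow> rep (a + b) x = rep a x + rep b x"
  using ring_hom_add [OF U_class_hom, of a n b] by (simp add: rep_def act_add_left U_class_closed)

lemma rep_mult:
  "a \<in> carrier (free_alg n) \<Longrightarrow> b \<in> carrier (free_alg n) \<Longrightarrow> rep (a * b) x = rep a (rep b x)"
  using ring_hom_mult [OF U_class_hom, of a n b] by (simp add: rep_def act_mult U_class_closed)

lemma rep_one: "rep 1 x = x"
  using ring_hom_one [OF U_class_hom, of n] by (simp add: rep_def act_one)

lemma rep_scal: "rep (scal c) = scale c"
  by (simp add: rep_def qv_scale_def)

lemma rep_zero: "rep 0 x = 0"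
  using rep_add [of 0 0 x] by (simp add: free_alg_closed)

lemma rep_minus: "a \<in> carrier (free_alg n) \<Longrightarrow> rep (- a) x = - rep a x"
  using rep_add [of a "- a" x] by (simp add: free_alg_closed rep_zero eq_neg_iff_add_eq_0 add.commute)

lemma rep_diff:
  "a \<in> carrier (free_alg n) \<Longrightarrow> b \<in> carrier (free_alg n) \<Longrightarrow> rep (a - b) x = rep a x - rep b x"
  using rep_add [of a "- b" x] by (simp add: free_alg_closed rep_minus)

lemma rep_zero_right: "a \<in> carrier (free_alg n) \<Longrightarrow> rep a 0 = 0"
  using rep_add_right [of a 0 0] by simp

lemma scal_commute: "scal c * a = a * scal c"
proof -
  have "Poly_Mapping.single 0 c * Poly_Mapping.single w d
      = Poly_Mapping.single w d * Poly_Mapping.single 0 c" for w :: "gen free_monoid" and d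
    by (simp add: mult_single mult.commute)
  then have "scal c * (\<Sum>w\<in>Poly_Mapping.keys a. Poly_Mapping.single w (Poly_Mapping.lookup a w))
      = (\<Sum>w\<in>Poly_Mapping.keys a. Poly_Mapping.single w (Poly_Mapping.lookup a w)) * scal c"
    by (simp add: scal_def sum_distrib_left sum_distrib_right)
  then show ?thesis by (simp add: sum_single_lookup)
qed

lemma rep_scale: "a \<in> carrier (free_alg n) \<Longrightarrow> rep a (scale c x) = scale c (rep a x)"
  by (metis rep_mult rep_scal scal_commute scal_in_free_alg)

lemmas rep_simps = rep_add rep_mult rep_one rep_scal rep_zero rep_minus rep_diff free_alg_closed

lemma rep_rel: "qq_rel n a b \<Longrightarrow> rep a x = rep b x"
  by (simp add: rep_def U_class_rel)

text \<open>
  Every element of the free algebra is a finite sum of scalar multiples of words in the generators,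
  so stability is passed from the generators first to words and then to sums.
\<close>

lemma rep_stable:
  assumes N: "subspace N"
    and gens: "\<And>g x. g \<in> gens n \<Longrightarrow> x \<in> N \<Longrightarrow> rep (var g) x \<in> N"
    and f: "f \<in> carrier (free_alg n)" and x: "x \<in> N"
  shows "rep f x \<in> N"
proof -
  have word: "Poly_Mapping.single (Word gs) c \<in> carrier (free_alg n)
      \<and> rep (Poly_Mapping.single (Word gs) c) x \<in> N" if "set gs \<subseteq> gens n" for gs c
    using that
  proof (induction gs)
    case Nil
    have "Poly_Mapping.single (Word []) c = scal c" by (simp add: scal_def zero_free_monoid_def)
    then show ?case using N x by (simp add: rep_scal scal_in_free_alg subspace_scale)
  next
    case (Cons g gs)
    have "Poly_Mapping.single (Word (g # gs)) c = var g * Poly_Mapping.single (Word gs) c"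
      by (simp add: var_def mult_single plus_free_monoid_def)
    then show ?case using Cons gens by (simp add: rep_mult free_alg_closed)
  qed
  have "(\<Sum>w\<in>W. Poly_Mapping.single w (Poly_Mapping.lookup f w)) \<in> carrier (free_alg n)
      \<and> rep (\<Sum>w\<in>W. Poly_Mapping.single w (Poly_Mapping.lookup f w)) x \<in> N"
    if "finite W" "W \<subseteq> Poly_Mapping.keys f" for W
    using that
  proof (induction W rule: finite_induct)
    case empty
    then show ?case using N by (simp add: rep_zero zero_in_free_alg subspace_0)
  next
    case (insert w W)
    have "set (letters w) \<subseteq> gens n" using insert.prems f by (auto simp: carrier_free_alg_iff)
    then have "Poly_Mapping.single w (Poly_Mapping.lookup f w) \<in> carrier (free_alg n)"
      "rep (Poly_Mapping.single w (Poly_Mapping.lookup f w)) x \<in> N"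
      using word [of "letters w" "Poly_Mapping.lookup f w"] by simp_all
    then show ?case using insert N by (simp add: rep_add free_alg_closed subspace_add)
  qed
  from this [of "Poly_Mapping.keys f"] show ?thesis by (simp add: sum_single_lookup)
qed

lemma submodule_if_gens_stable:
  assumes N: "subspace N"
    and gens: "\<And>g x. g \<in> gens n \<Longrightarrow> x \<in> N \<Longrightarrow> rep (var g) x \<in> N"
  shows "submodule_of (Uv n) act N"
  unfolding submodule_of_def
proof (intro conjI ballI)
  fix a x assume a: "a \<in> carrier (Uv n)" and x: "x \<in> N"
  obtain f where "f \<in> carrier (free_alg n)" "a = U_class n f"
    using a unfolding Uv_def FactRing_def U_class_def A_RCOSETS_def' by auto
  then show "act a x \<in> N" using rep_stable [OF N gens _ x] by (simp add: rep_def)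
qed (use N in \<open>auto simp: subspace_def\<close>)


section \<open>Weight spaces\<close>

lemma weight_space_iff:
  "x \<in> weight_space n act \<omega> \<longleftrightarrow> (\<forall>i\<in>{1..n}. rep (xK i) x = scale (\<omega> i) x)"
  by (simp add: weight_space_def rep_def)

lemma subspace_weight_space: "subspace (weight_space n act \<omega>)"
  by (auto simp: subspace_def weight_space_iff rep_add_right rep_zero_right rep_scale
      free_alg_closed scale_right_distrib mult.commute)

lemma rep_raising:
  assumes "j \<in> {1..n-1}" "X \<in> {xE j, xEbar j}" "x \<in> weight_space n act \<omega>"
  shows "rep X x \<in> weight_space n act (vshift n (alpha j) \<omega>)"
  unfolding weight_space_iff
proof
  fix i assume i: "i \<in> {1..n}"
  have X: "X \<in> carrier (free_alg n)" using assms by (auto intro: var_in_free_alg)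
  show "rep (xK i) (rep X x) = scale (vshift n (alpha j) \<omega> i) (rep X x)"
    using rep_rel [OF QQ2a [OF i assms(1,2)], of x] assms(3) i X
    by (simp add: rep_simps form_eps weight_space_iff rep_scale vshift_def)
qed

lemma rep_lowering:
  assumes "j \<in> {1..n-1}" "X \<in> {xF j, xFbar j}" "x \<in> weight_space n act \<omega>"
  shows "rep X x \<in> weight_space n act (vshift n (\<lambda>i. - alpha j i) \<omega>)"
  unfolding weight_space_iff
proof
  fix i assume i: "i \<in> {1..n}"
  have X: "X \<in> carrier (free_alg n)" using assms by (auto intro: var_in_free_alg)
  show "rep (xK i) (rep X x) = scale (vshift n (\<lambda>i. - alpha j i) \<omega> i) (rep X x)"
    using rep_rel [OF QQ2b [OF i assms(1,2)], of x] assms(3) i X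
    by (simp add: rep_simps form_eps weight_space_iff rep_scale vshift_def)
qed

lemma rep_Kbar_weight_space:
  assumes "i \<in> {1..n}" "x \<in> weight_space n act \<omega>"
  shows "rep (xKbar i) x \<in> weight_space n act \<omega>"
  unfolding weight_space_iff
proof
  fix j assume j: "j \<in> {1..n}"
  show "rep (xK j) (rep (xKbar i) x) = scale (\<omega> j) (rep (xKbar i) x)"
    using rep_rel [OF QQ1d [OF j assms(1)], of x] assms j
    by (simp add: rep_simps weight_space_iff rep_scale)
qed

lemma Kinv_K: "i \<in> {1..n} \<Longrightarrow> rep (xKinv i) (rep (xK i) x) = x"
  using rep_rel [OF QQ1b, of i x] by (simp add: rep_simps)

lemma K_Kinv: "i \<in> {1..n} \<Longrightarrow> rep (xK i) (rep (xKinv i) x) = x"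
  using rep_rel [OF QQ1a, of i x] by (simp add: rep_simps)

text \<open>
  The operator $\mathsf K_i$ acts on the weight space by the nonzero scalar $\omega_i$, so its
  inverse acts by $\omega_i^{-1}$.
\<close>

lemma rep_Kinv_weight_space:
  assumes "i \<in> {1..n}" "\<omega> \<in> Pn n" "x \<in> weight_space n act \<omega>"
  shows "rep (xKinv i) x \<in> weight_space n act \<omega>"
proof -
  have "scale (\<omega> i) (rep (xKinv i) x) = x"
    using Kinv_K [OF assms(1), of x] assms by (simp add: weight_space_iff rep_scale free_alg_closed)
  moreover have "\<omega> i \<noteq> 0" using assms by (auto simp: Pn_def)
  ultimately have "rep (xKinv i) x = scale (inverse (\<omega> i)) x"
    by (metis left_inverse scale_one scale_scale)
  then show ?thesis using assms(3) subspace_weight_space by (simp add: subspace_scale)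
qed

text \<open>
  A nonzero image would have the weight $v^{\alpha_j}\omega > \omega$.
\<close>

lemma rep_raising_maximal:
  assumes "maximal_weight n act \<omega>" "j \<in> {1..n-1}" "X \<in> {xE j, xEbar j}"
    and "x \<in> weight_space n act \<omega>"
  shows "rep X x = 0"
proof (rule ccontr)
  assume nz: "rep X x \<noteq> 0"
  have \<omega>: "\<omega> \<in> Pn n" using assms(1) by (auto simp: maximal_weight_def wt_def)
  have "vshift n (alpha j) \<omega> \<in> wt n act"
    using rep_raising [OF assms(2-4)] nz vshift_in_Pn [OF \<omega>] by (auto simp: wt_def)
  then show False
    using assms(1) weight_gt_vshift_alpha [OF assms(2) \<omega>] by (auto simp: maximal_weight_def)
qed


section \<open>The span of the lowerings of a weight space\<close>

text \<open>
  This plays the role of $U^- M_\omega$: the smallest subspace that contains $M_\omega$ and is stable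
  under the lowering operators. Its closure under sums and scalars is part of the inductive
  definition, so that one rule induction treats words and linear combinations at once.
\<close>

inductive_set lowerings :: "(nat \<Rightarrow> ratfun) \<Rightarrow> 'm set" for \<omega> where
  weight: "x \<in> weight_space n act \<omega> \<Longrightarrow> x \<in> lowerings \<omega>"
| add: "x \<in> lowerings \<omega> \<Longrightarrow> y \<in> lowerings \<omega> \<Longrightarrow> x + y \<in> lowerings \<omega>"
| scale: "x \<in> lowerings \<omega> \<Longrightarrow> qv_scale n act c x \<in> lowerings \<omega>"
| F: "x \<in> lowerings \<omega> \<Longrightarrow> j \<in> {1..n-1} \<Longrightarrow> rep (xF j) x \<in> lowerings \<omega>"
| Fbar: "x \<in> lowerings \<omega> \<Longrightarrow> j \<in> {1..n-1} \<Longrightarrow> rep (xFbar j) x \<in> lowerings \<omega>"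

lemma subspace_lowerings: "subspace (lowerings \<omega>)"
  unfolding subspace_def
  using subspace_0 [OF subspace_weight_space] by (blast intro: lowerings.intros)

lemma lowerings_diff: "x \<in> lowerings \<omega> \<Longrightarrow> y \<in> lowerings \<omega> \<Longrightarrow> x - y \<in> lowerings \<omega>"
  by (rule subspace_diff [OF subspace_lowerings])

lemma lowerings_minus: "x \<in> lowerings \<omega> \<Longrightarrow> - x \<in> lowerings \<omega>"
  by (rule subspace_neg [OF subspace_lowerings])

lemma lowerings_unscale:
  assumes "scale c x \<in> lowerings \<omega>" "c \<noteq> 0"
  shows "x \<in> lowerings \<omega>"
  using lowerings.scale [OF assms(1), of "inverse c"] assms(2) by simp

lemmas lowerings_closed = lowerings.add lowerings.scale lowerings.F lowerings.Fbar
  lowerings_diff lowerings_minus subspace_0 [OF subspace_lowerings]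

text \<open>
  Induction principle for stability under an operator $a$: it suffices to check $a$ on $M_\omega$
  and to move it past one lowering operator at a time.
\<close>

lemma lowerings_stable_by_generators:
  assumes a: "a \<in> carrier (free_alg n)"
    and "\<And>x. x \<in> weight_space n act \<omega> \<Longrightarrow> rep a x \<in> lowerings \<omega>"
    and "\<And>x j X. x \<in> lowerings \<omega> \<Longrightarrow> rep a x \<in> lowerings \<omega> \<Longrightarrow> j \<in> {1..n-1} \<Longrightarrow>
      X \<in> {xF j, xFbar j} \<Longrightarrow> rep a (rep X x) \<in> lowerings \<omega>"
    and "x \<in> lowerings \<omega>"
  shows "rep a x \<in> lowerings \<omega>"
  using assms(4) by induction (simp_all add: assms lowerings_closed rep_add_right rep_scale)

lemma K_lowerings:
  assumes i: "i \<in> {1..n}" and x: "x \<in> lowerings \<omega>"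
  shows "rep (xK i) x \<in> lowerings \<omega>"
proof (rule lowerings_stable_by_generators [OF _ _ _ x])
  show "rep (xK i) x \<in> lowerings \<omega>" if "x \<in> weight_space n act \<omega>" for x
    using that i lowerings.weight [OF that] by (simp add: weight_space_iff lowerings.scale)
  show "rep (xK i) (rep X x) \<in> lowerings \<omega>"
    if "rep (xK i) x \<in> lowerings \<omega>" "j \<in> {1..n-1}" "X \<in> {xF j, xFbar j}" for x j X
    using rep_rel [OF QQ2b [OF i that(2,3)], of x] that i by (auto simp: rep_simps lowerings_closed)
qed (use i in \<open>simp add: free_alg_closed\<close>)

lemma Kinv_lowerings:
  assumes \<omega>: "\<omega> \<in> Pn n" and i: "i \<in> {1..n}" and x: "x \<in> lowerings \<omega>"
  shows "rep (xKinv i) x \<in> lowerings \<omega>"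
proof (rule lowerings_stable_by_generators [OF _ _ _ x])
  show "rep (xKinv i) x \<in> lowerings \<omega>" if "x \<in> weight_space n act \<omega>" for x
    using rep_Kinv_weight_space [OF i \<omega> that] by (rule lowerings.weight)
  show "rep (xKinv i) (rep X x) \<in> lowerings \<omega>"
    if IH: "rep (xKinv i) x \<in> lowerings \<omega>" and j: "j \<in> {1..n-1}" "X \<in> {xF j, xFbar j}" for x j X
  proof -
    have X: "X \<in> carrier (free_alg n)" using j by (auto intro: var_in_free_alg)
    (* Conjugate K_i X = c X K_i by the inverse of K_i: apply both sides to K_i^{-1} x
       and then K_i^{-1} to both results. *)
    let ?c = "qv powi (- form n (eps i) (alpha j))"
    have "rep (xKinv i) (rep (xK i) (rep X (rep (xKinv i) x)))
        = rep (xKinv i) (scale ?c (rep X (rep (xK i) (rep (xKinv i) x))))"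
      using rep_rel [OF QQ2b [OF i j], of "rep (xKinv i) x"] i X by (simp add: rep_simps)
    then have "rep X (rep (xKinv i) x) = scale ?c (rep (xKinv i) (rep X x))"
      using i by (simp add: Kinv_K K_Kinv rep_scale free_alg_closed)
    moreover have "rep X (rep (xKinv i) x) \<in> lowerings \<omega>"
      using j IH by (auto intro: lowerings.intros)
    ultimately have "scale ?c (rep (xKinv i) (rep X x)) \<in> lowerings \<omega>" by simp
    then show ?thesis by (rule lowerings_unscale) (simp add: qv_nonzero)
  qed
qed (use i in \<open>simp add: free_alg_closed\<close>)

text \<open>
  The relations express $\mathsf K_{\bar i} X$, for a lowering operator $X$ with index $j$, by
  lowering operators composed with $\mathsf K_{\bar i}$ and $\mathsf K_i$. Their shape depends on
  whether $j = i$, $j = i - 1$ or neither; for $j = i - 1$ they yield $v\,\mathsf K_{\bar i} X$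
  instead, from which the unit $v$ has to be removed.
\<close>

lemma Kbar_lowerings:
  assumes i: "i \<in> {1..n}" and x: "x \<in> lowerings \<omega>"
  shows "rep (xKbar i) x \<in> lowerings \<omega>"
proof (rule lowerings_stable_by_generators [OF _ _ _ x])
  show "rep (xKbar i) x \<in> lowerings \<omega>" if "x \<in> weight_space n act \<omega>" for x
    using rep_Kbar_weight_space [OF i that] by (rule lowerings.weight)
  show "rep (xKbar i) (rep X x) \<in> lowerings \<omega>"
    if x: "x \<in> lowerings \<omega>" and IH: "rep (xKbar i) x \<in> lowerings \<omega>"
      and j: "j \<in> {1..n-1}" and X: "X \<in> {xF j, xFbar j}" for x j X
  proof -
    consider "j = i" | "j = i - 1" "i \<in> {2..n}" | "j \<noteq> i" "j \<noteq> i - 1" using i j by force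
    then have "rep (xKbar i) (rep (xF j) x) \<in> lowerings \<omega> \<and>
        rep (xKbar i) (rep (xFbar j) x) \<in> lowerings \<omega>"
    proof cases
      case 1
      have "rep (xKbar i) (rep (xF j) x)
          = scale qv (rep (xF j) (rep (xKbar i) x)) - rep (xFbar j) (rep (xK i) x)"
        using rep_rel [OF QQ3c, of i x] i j 1 by (simp add: rep_simps algebra_simps)
      moreover have "rep (xKbar i) (rep (xFbar j) x)
          = rep (xF j) (rep (xK i) x) - scale qv (rep (xFbar j) (rep (xKbar i) x))"
        using rep_rel [OF QQ3g, of i x] i j 1 by (simp add: rep_simps algebra_simps)
      ultimately show ?thesis using x IH i j by (simp add: lowerings_closed K_lowerings)
    next
      case 2
      have "scale qv (rep (xKbar i) (rep (xF j) x))
          = rep (xF j) (rep (xKbar i) x) + rep (xK i) (rep (xFbar j) x)"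
        using rep_rel [OF QQ3d, of i x] i j 2 by (simp add: rep_simps algebra_simps)
      moreover have "scale qv (rep (xKbar i) (rep (xFbar j) x))
          = rep (xK i) (rep (xF j) x) - rep (xFbar j) (rep (xKbar i) x)"
        using rep_rel [OF QQ3h, of i x] i j 2 by (simp add: rep_simps algebra_simps)
      ultimately have "scale qv (rep (xKbar i) (rep (xF j) x)) \<in> lowerings \<omega>"
        "scale qv (rep (xKbar i) (rep (xFbar j) x)) \<in> lowerings \<omega>"
        using x IH i j by (simp_all add: lowerings_closed K_lowerings)
      then show ?thesis using lowerings_unscale qv_nonzero by blast
    next
      case 3
      have "rep (xKbar i) (rep (xF j) x) = rep (xF j) (rep (xKbar i) x)"
        using rep_rel [OF QQ3j [OF i j 3], of x] i j by (simp add: rep_simps algebra_simps)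
      moreover have "rep (xKbar i) (rep (xFbar j) x) = - rep (xFbar j) (rep (xKbar i) x)"
        using rep_rel [OF QQ3l [OF i j 3], of x] i j
        by (simp add: rep_simps eq_neg_iff_add_eq_0)
      ultimately show ?thesis using IH j by (simp add: lowerings_closed)
    qed
    then show ?thesis using X by auto
  qed
qed (use i in \<open>simp add: free_alg_closed\<close>)

text \<open>
  Each raising operator (super)commutes with each lowering operator up to an expression in
  $\mathsf K_k^{\pm1}$ and $\mathsf K_{\bar k}$, and these are already known to preserve
  the subspace. The base of the induction is where maximality of $\omega$ enters.
\<close>

lemma raising_lowerings:
  assumes \<omega>: "maximal_weight n act \<omega>" and i: "i \<in> {1..n-1}" and Y: "Y \<in> {xE i, xEbar i}"
    and x: "x \<in> lowerings \<omega>"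
  shows "rep Y x \<in> lowerings \<omega>"
proof (rule lowerings_stable_by_generators [OF _ _ _ x])
  have \<omega>': "\<omega> \<in> Pn n" using \<omega> by (auto simp: maximal_weight_def wt_def)
  have i': "i \<in> {1..n}" "i + 1 \<in> {1..n}" using i by auto
  show "rep Y x \<in> lowerings \<omega>" if "x \<in> weight_space n act \<omega>" for x
    using rep_raising_maximal [OF \<omega> i Y that] by (simp add: lowerings_closed)
  show "rep Y (rep X x) \<in> lowerings \<omega>"
    if x: "x \<in> lowerings \<omega>" and IH: "rep Y x \<in> lowerings \<omega>"
      and j: "j \<in> {1..n-1}" and X: "X \<in> {xF j, xFbar j}" for x j X
  proof -
    note cl = lowerings_closed K_lowerings Kinv_lowerings [OF \<omega>'] Kbar_lowerings
    have "rep (xE i) (rep (xF j) x) \<in> lowerings \<omega>" if "rep (xE i) x \<in> lowerings \<omega>"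
    proof -
      have "rep (xE i) (rep (xF j) x) = rep (xF j) (rep (xE i) x) +
          (if i = j then scale (1 / (qv - inverse qv))
             (rep (xK i) (rep (xKinv (i+1)) x) - rep (xKinv i) (rep (xK (i+1)) x)) else 0)"
        using rep_rel [OF QQ4a [OF i j], of x] i i' j
        by (cases "i = j") (simp_all add: rep_simps diff_eq_eq add.commute)
      then show ?thesis using that x i' j by (simp add: cl)
    qed
    moreover have "rep (xEbar i) (rep (xFbar j) x) \<in> lowerings \<omega>"
      if "rep (xEbar i) x \<in> lowerings \<omega>"
    proof -
      have "rep (xEbar i) (rep (xFbar j) x) =
          (if i = j then scale (1 / (qv - inverse qv))
             (rep (xK i) (rep (xK (i+1)) x) - rep (xKinv i) (rep (xKinv (i+1)) x))
             + scale (qv - inverse qv) (rep (xKbar i) (rep (xKbar (i+1)) x)) else 0)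
          - rep (xFbar j) (rep (xEbar i) x)"
        using rep_rel [OF QQ4b [OF i j], of x] i i' j
        by (cases "i = j") (simp_all add: rep_simps eq_diff_eq eq_neg_iff_add_eq_0)
      then show ?thesis using that x i' j by (simp add: cl)
    qed
    moreover have "rep (xE i) (rep (xFbar j) x) \<in> lowerings \<omega>" if "rep (xE i) x \<in> lowerings \<omega>"
    proof -
      have "rep (xE i) (rep (xFbar j) x) = rep (xFbar j) (rep (xE i) x) +
          (if i = j then rep (xKinv (i+1)) (rep (xKbar i) x) - rep (xKbar (i+1)) (rep (xKinv i) x)
           else 0)"
        using rep_rel [OF QQ4c [OF i j], of x] i i' j
        by (cases "i = j") (simp_all add: rep_simps diff_eq_eq add.commute)
      then show ?thesis using that x i' j by (simp add: cl)
    qed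
    moreover have "rep (xEbar i) (rep (xF j) x) \<in> lowerings \<omega>"
      if "rep (xEbar i) x \<in> lowerings \<omega>"
    proof -
      have "rep (xEbar i) (rep (xF j) x) = rep (xF j) (rep (xEbar i) x) +
          (if i = j then rep (xK (i+1)) (rep (xKbar i) x) - rep (xKbar (i+1)) (rep (xK i) x)
           else 0)"
        using rep_rel [OF QQ4d [OF i j], of x] i i' j
        by (cases "i = j") (simp_all add: rep_simps diff_eq_eq add.commute)
      then show ?thesis using that x i' j by (simp add: cl)
    qed
    ultimately show ?thesis using X Y IH by auto
  qed
  show "Y \<in> carrier (free_alg n)" using Y i by (auto intro: var_in_free_alg)
qed

lemma submodule_lowerings:
  assumes "maximal_weight n act \<omega>"
  shows "submodule_of (Uv n) act (lowerings \<omega>)"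
proof (rule submodule_if_gens_stable [OF subspace_lowerings])
  fix g x assume g: "g \<in> gens n" and x: "x \<in> lowerings \<omega>"
  have \<omega>: "\<omega> \<in> Pn n" using assms by (auto simp: maximal_weight_def wt_def)
  show "rep (var g) x \<in> lowerings \<omega>"
    using g x K_lowerings Kinv_lowerings [OF \<omega>] Kbar_lowerings raising_lowerings [OF assms]
    by (cases g) (auto intro: lowerings.intros)
qed

text \<open>
  The span of the weight spaces below $\omega$ contains $M_\omega$ and is stable under lowering
  operators, since they map $M_\gamma$ to $M_{v^{-\alpha_j}\gamma}$.
\<close>

lemma lowerings_subset_span:
  assumes "\<omega> \<in> Pn n"
  shows "lowerings \<omega> \<subseteq> span (\<Union>\<gamma> \<in> {\<gamma> \<in> Pn n. weight_ge n \<omega> \<gamma>}. weight_space n act \<gamma>)"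
    (is "_ \<subseteq> span ?S")
proof
  have lower: "rep X x \<in> span ?S"
    if j: "j \<in> {1..n-1}" "X \<in> {xF j, xFbar j}" and x: "x \<in> span ?S" for j X x
    using x
  proof (induction rule: span_induct)
    case base
    have X: "X \<in> carrier (free_alg n)" using j by (auto intro: var_in_free_alg)
    show ?case
      by (auto simp: subspace_def rep_add_right rep_zero_right rep_scale X
          intro: span_add span_scale span_zero)
  next
    case (step x)
    then obtain \<gamma> where \<gamma>: "\<gamma> \<in> Pn n" "weight_ge n \<omega> \<gamma>" "x \<in> weight_space n act \<gamma>"
      by blast
    let ?\<delta> = "vshift n (\<lambda>i. - alpha j i) \<gamma>"
    have "?\<delta> \<in> Pn n" "weight_ge n \<omega> ?\<delta>"
      using \<gamma> vshift_in_Pn weight_ge_trans weight_ge_vshift_minus_alpha [OF j(1)] by metis+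
    then show ?case using rep_lowering [OF j \<gamma>(3)] by (intro span_base) auto
  qed
  fix x assume "x \<in> lowerings \<omega>"
  then show "x \<in> span ?S"
  proof induction
    case (weight x)
    then show ?case using assms weight_ge_refl by (intro span_base) blast
  qed (auto intro: span_add span_scale lower)
qed


section \<open>Weight components\<close>

text \<open>
  The property of the family $f$ whose unique existence, for every vector, is the definition of a
  weight module. It is named here so that decompositions can be added and scaled.
\<close>

definition weight_decomposition :: "'m \<Rightarrow> ((nat \<Rightarrow> ratfun) \<Rightarrow> 'm) \<Rightarrow> bool" where
  "weight_decomposition m f \<longleftrightarrow>
     (\<forall>\<omega>\<in>wt n act. f \<omega> \<in> weight_space n act \<omega>) \<and> (\<forall>\<omega>. \<omega> \<notin> wt n act \<longrightarrow> f \<omega> = 0) \<and>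
     finite {\<omega>. f \<omega> \<noteq> 0} \<and> m = (\<Sum>\<omega> | f \<omega> \<noteq> 0. f \<omega>)"

lemma weight_decomposition_add:
  assumes "weight_decomposition x f" "weight_decomposition y g"
  shows "weight_decomposition (x + y) (\<lambda>\<omega>. f \<omega> + g \<omega>)"
proof -
  let ?S = "{\<omega>. f \<omega> \<noteq> 0} \<union> {\<omega>. g \<omega> \<noteq> 0}"
  have fin: "finite ?S" using assms by (auto simp: weight_decomposition_def)
  have "x = sum f ?S" "y = sum g ?S"
    using assms fin unfolding weight_decomposition_def
    by (auto intro!: sum.mono_neutral_left)
  then have "x + y = (\<Sum>\<omega>\<in>?S. f \<omega> + g \<omega>)" by (simp add: sum.distrib)
  also have "\<dots> = (\<Sum>\<omega> | f \<omega> + g \<omega> \<noteq> 0. f \<omega> + g \<omega>)"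
    using fin by (auto intro!: sum.mono_neutral_right)
  moreover have "finite {\<omega>. f \<omega> + g \<omega> \<noteq> 0}"
    by (rule finite_subset [OF _ fin]) auto
  ultimately show ?thesis
    using assms subspace_weight_space
    by (simp add: weight_decomposition_def subspace_add)
qed

lemma weight_decomposition_scale:
  assumes "weight_decomposition x f"
  shows "weight_decomposition (scale c x) (\<lambda>\<omega>. scale c (f \<omega>))"
proof -
  have fin: "finite {\<omega>. f \<omega> \<noteq> 0}" and x: "x = (\<Sum>\<omega> | f \<omega> \<noteq> 0. f \<omega>)"
    using assms by (auto simp: weight_decomposition_def)
  have "scale c x = (\<Sum>\<omega> | f \<omega> \<noteq> 0. scale c (f \<omega>))"
    unfolding x by (rule scale_sum_right)
  also have "\<dots> = (\<Sum>\<omega> | scale c (f \<omega>) \<noteq> 0. scale c (f \<omega>))"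
    using fin by (auto intro!: sum.mono_neutral_right)
  moreover have "finite {\<omega>. scale c (f \<omega>) \<noteq> 0}"
    by (rule finite_subset [OF _ fin]) auto
  ultimately show ?thesis
    using assms subspace_weight_space
    by (simp add: weight_decomposition_def subspace_scale del: scale_eq_0_iff)
qed

lemma weight_decomposition_single:
  assumes "\<gamma> \<in> Pn n" "x \<in> weight_space n act \<gamma>"
  shows "weight_decomposition x (\<lambda>\<omega>. if \<omega> = \<gamma> then x else 0)"
  using assms subspace_0 [OF subspace_weight_space]
  by (cases "x = 0") (auto simp: weight_decomposition_def wt_def)

text \<open>
  Adding up decompositions gives every vector one that is supported in $\Gamma$. For a weight vector of
  weight $\gamma$ it must coincide, by uniqueness, with the decomposition that has the vector itself at
  $\gamma$, so $\gamma \in \Gamma$. With a basis for $S$ this bounds the number of weights; with weight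
  vectors below $\omega$ for $S$ it bounds the weights from above.
\<close>

lemma wt_subset_if_spanning:
  assumes M: "weight_module n act"
    and ex: "\<And>x. x \<in> S \<Longrightarrow> \<exists>f. weight_decomposition x f \<and> {\<omega>. f \<omega> \<noteq> 0} \<subseteq> \<Gamma>"
    and S: "span S = UNIV"
  shows "wt n act \<subseteq> \<Gamma>"
proof
  have uniq: "f = g" if "weight_decomposition x f" "weight_decomposition x g" for x f g
    using M that unfolding weight_module_def weight_decomposition_def by blast
  fix \<gamma> assume "\<gamma> \<in> wt n act"
  then obtain y where y: "\<gamma> \<in> Pn n" "y \<in> weight_space n act \<gamma>" "y \<noteq> 0"
    using subspace_0 [OF subspace_weight_space, of \<gamma>] by (auto simp: wt_def)
  have zero: "weight_decomposition 0 (\<lambda>\<omega>. 0)"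
    by (simp add: weight_decomposition_def subspace_0 [OF subspace_weight_space])
  have "y \<in> span S" by (simp add: S)
  then have "\<exists>f. weight_decomposition y f \<and> {\<omega>. f \<omega> \<noteq> 0} \<subseteq> \<Gamma>"
  proof (induction rule: span_induct_alt)
    case base
    then show ?case using zero by force
  next
    case (step c x y)
    then obtain f where f: "weight_decomposition y f" "{\<omega>. f \<omega> \<noteq> 0} \<subseteq> \<Gamma>" by blast
    obtain g where g: "weight_decomposition x g" "{\<omega>. g \<omega> \<noteq> 0} \<subseteq> \<Gamma>"
      using ex [OF step(1)] by blast
    have "{\<omega>. scale c (g \<omega>) + f \<omega> \<noteq> 0} \<subseteq> {\<omega>. g \<omega> \<noteq> 0} \<union> {\<omega>. f \<omega> \<noteq> 0}" by auto
    then have "{\<omega>. scale c (g \<omega>) + f \<omega> \<noteq> 0} \<subseteq> \<Gamma>" using f(2) g(2) by blast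
    then show ?case
      using weight_decomposition_add [OF weight_decomposition_scale [OF g(1)] f(1)] by blast
  qed
  then obtain f where f: "weight_decomposition y f" "{\<omega>. f \<omega> \<noteq> 0} \<subseteq> \<Gamma>" by blast
  have "f = (\<lambda>\<omega>. if \<omega> = \<gamma> then y else 0)"
    by (rule uniq [OF f(1) weight_decomposition_single [OF y(1,2)]])
  then show "\<gamma> \<in> \<Gamma>" using f(2) y(3) by auto
qed

lemma finite_wt:
  assumes "weight_module n act" "finite_dim_module n act"
  shows "finite (wt n act)"
proof -
  obtain B where "finite_dimensional_vector_space scale B"
    using assms(2) unfolding finite_dim_module_def by blast
  then interpret fd: finite_dimensional_vector_space scale B .
  have "\<forall>x. \<exists>f. weight_decomposition x f"
    using assms(1) unfolding weight_module_def weight_decomposition_def by blast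
  then obtain d where d: "\<And>x. weight_decomposition x (d x)" by metis
  have "wt n act \<subseteq> (\<Union>b\<in>B. {\<omega>. d b \<omega> \<noteq> 0})"
    by (rule wt_subset_if_spanning [OF assms(1) _ fd.span_Basis]) (use d in auto)
  moreover have "finite (\<Union>b\<in>B. {\<omega>. d b \<omega> \<noteq> 0})"
    using fd.finite_Basis d by (auto simp: weight_decomposition_def)
  ultimately show ?thesis by (rule finite_subset)
qed

lemma wt_nonempty:
  assumes "weight_module n act" "(UNIV :: 'm set) \<noteq> {0}"
  shows "wt n act \<noteq> {}"
proof
  assume empty: "wt n act = {}"
  obtain m :: 'm where m: "m \<noteq> 0" using assms(2) by blast
  obtain f where "weight_decomposition m f"
    using assms(1) unfolding weight_module_def weight_decomposition_def by blast
  then show False using empty m by (simp add: weight_decomposition_def)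
qed

lemma weight_ge_if_lowerings_UNIV:
  assumes "weight_module n act" "\<omega> \<in> Pn n" "lowerings \<omega> = UNIV" "\<gamma> \<in> wt n act"
  shows "weight_ge n \<omega> \<gamma>"
proof -
  let ?\<Gamma> = "{\<gamma> \<in> Pn n. weight_ge n \<omega> \<gamma>}"
  let ?S = "\<Union>\<gamma> \<in> ?\<Gamma>. weight_space n act \<gamma>"
  have "\<exists>f. weight_decomposition x f \<and> {\<omega>. f \<omega> \<noteq> 0} \<subseteq> ?\<Gamma>" if x: "x \<in> ?S" for x
  proof -
    obtain \<gamma> where "\<gamma> \<in> ?\<Gamma>" "x \<in> weight_space n act \<gamma>" using x by blast
    then show ?thesis
      by (intro exI [of _ "\<lambda>\<omega>. if \<omega> = \<gamma> then x else 0"]) (auto intro: weight_decomposition_single)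
  qed
  moreover have "span ?S = UNIV" using lowerings_subset_span [OF assms(2)] assms(3) by auto
  ultimately have "wt n act \<subseteq> ?\<Gamma>" by (intro wt_subset_if_spanning [OF assms(1)])
  then show ?thesis using assms(4) by blast
qed

lemma lowerings_eq_UNIV:
  assumes "irreducible_module (Uv n) act" "maximal_weight n act \<omega>"
  shows "lowerings \<omega> = UNIV"
proof -
  have "weight_space n act \<omega> \<noteq> {0}" using assms(2) by (auto simp: maximal_weight_def wt_def)
  then obtain m where "m \<in> weight_space n act \<omega>" "m \<noteq> 0"
    using subspace_0 [OF subspace_weight_space, of \<omega>] by blast
  then have "lowerings \<omega> \<noteq> {0}" using lowerings.weight by blast
  then show ?thesis
    using assms(1) submodule_lowerings [OF assms(2)] unfolding irreducible_module_def by blast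
qed

lemma highest_weight_module_if_maximal:
  assumes "irreducible_module (Uv n) act" "maximal_weight n act \<omega>"
  shows "highest_weight_module n act \<omega>"
proof -
  have "\<omega> \<in> wt n act" using assms(2) by (simp add: maximal_weight_def)
  then obtain m where m: "\<omega> \<in> Pn n" "m \<in> weight_space n act \<omega>" "m \<noteq> 0"
    using subspace_0 [OF subspace_weight_space, of \<omega>] by (auto simp: wt_def)
  have "highest_weight_vector n act \<omega> m"
    using m rep_raising_maximal [OF assms(2) _ _ m(2)]
    by (auto simp: highest_weight_vector_def rep_def)
  moreover have "submodule_of (Uv n) act hull {m} = UNIV"
  proof -
    have "N = UNIV" if "submodule_of (Uv n) act N" "m \<in> N" for N
      using assms(1) m(3) that unfolding irreducible_module_def by blast
    then show ?thesis unfolding hull_def by auto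
  qed
  ultimately show ?thesis unfolding highest_weight_module_def by blast
qed

end

theorem proposition3p3:
  fixes n :: nat and act :: "free_el set \<Rightarrow> 'm :: ab_group_add \<Rightarrow> 'm"
  assumes "n \<ge> 2"
    and "left_module (Uv n) act"
    and "finite_dim_module n act"
    and "irreducible_module (Uv n) act"
    and "weight_module n act"
  shows "(\<exists>!\<omega>. maximal_weight n act \<omega>) \<and>
    (\<forall>\<omega>. maximal_weight n act \<omega> \<longrightarrow> highest_weight_module n act \<omega>)"
proof -
  interpret qq_module n act using assms(2) by (simp add: qq_module_def)
  have wt_Pn: "wt n act \<subseteq> Pn n" by (auto simp: wt_def)
  have "wt n act \<noteq> {}"
    using wt_nonempty [OF assms(5)] assms(4) by (simp add: irreducible_module_def)
  then have "\<exists>\<omega>\<in>wt n act. \<not> (\<exists>\<gamma>\<in>wt n act. weight_gt n \<gamma> \<omega>)"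
    using ex_maximal_for_weight_gt [OF finite_wt [OF assms(5,3)] _ wt_Pn] by simp
  then have "\<exists>\<omega>. maximal_weight n act \<omega>" by (auto simp: maximal_weight_def)
  moreover have "\<gamma> = \<omega>" if max: "maximal_weight n act \<omega>" "maximal_weight n act \<gamma>" for \<omega> \<gamma>
  proof -
    have "\<omega> \<in> wt n act" "\<gamma> \<in> wt n act" using max by (auto simp: maximal_weight_def)
    then have "weight_ge n \<omega> \<gamma>"
      using weight_ge_if_lowerings_UNIV [OF assms(5) _ lowerings_eq_UNIV [OF assms(4) max(1)]] wt_Pn
      by blast
    then show "\<gamma> = \<omega>"
      using max(2) \<open>\<omega> \<in> wt n act\<close> by (auto simp: maximal_weight_def weight_gt_def)
  qed
  ultimately have "\<exists>!\<omega>. maximal_weight n act \<omega>" by blast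
  then show ?thesis using highest_weight_module_if_maximal [OF assms(4)] by blast
qed

end
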